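(* Let $G$ be a graph that has an induced $k$-partite representation in the hypercube. Then the maximum number of edges of a subgraph of $Q_n$ containing no induced copy of $G$ is $o(|E(Q_n)|)$ as $n\to\infty$.
   Context: Identify the vertices of the hypercube $Q_n$ with subsets of $[n]$, two being adjacent iff their symmetric difference has size $1$; the $k$-th vertex layer is $\binom{[n]}{k}$. A down $k$-star is the star consisting of a vertex $X$ of the $k$-th vertex layer together with its $k$ edges to the $(k-1)$-th vertex layer. For a set $A$ of vertices in the $k$-th vertex layer of $Q_n$, $\mathcal H_A$ is the $k$-uniform hypergraph on $[n]$ whose edges are the sets in $A$. A graph $G$ has a (partite) representation if there are integers $k,n$ and a set $A$ of vertices of the $k$-th vertex layer of $Q_n$ such that $\mathcal H_A$ is $k$-partite (its vertex set splits into $k$ parts, each edge meeting every part in exactly one vertex) and $G$ is isomorphic to a subgraph $G'$ of the union of the down $k$-stars centered at the vertices of $A$; the representation is induced if $G'$ is an induced subgraph of $Q_n$. *)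

theory Defs
  imports Complex_Main "HOL-Library.Landau_Symbols" "HOL-Library.Disjoint_Sets"
begin

text \<open>A graph (or hypergraph) is a pair of a vertex set and a set of edges; the edges are
  themselves sets of vertices.\<close>

type_synonym 'a ugraph = "'a set \<times> 'a set set"

abbreviation verts :: "'a ugraph \<Rightarrow> 'a set" where "verts \<equiv> fst"
abbreviation edges :: "'a ugraph \<Rightarrow> 'a set set" where "edges \<equiv> snd"

definition simple_graph :: "'a ugraph \<Rightarrow> bool" where
  "simple_graph G \<longleftrightarrow> finite (verts G) \<and> (\<forall>e \<in> edges G. e \<subseteq> verts G \<and> card e = 2)"

definition subgraph :: "'a ugraph \<Rightarrow> 'a ugraph \<Rightarrow> bool" where
  "subgraph H G \<longleftrightarrow> simple_graph H \<and> verts H \<subseteq> verts G \<and> edges H \<subseteq> edges G"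

definition induced_subgraph :: "'a ugraph \<Rightarrow> 'a ugraph \<Rightarrow> bool" where
  "induced_subgraph H G \<longleftrightarrow> subgraph H G \<and> edges H = {e \<in> edges G. e \<subseteq> verts H}"

definition isomorphic :: "'a ugraph \<Rightarrow> 'b ugraph \<Rightarrow> bool" where
  "isomorphic G H \<longleftrightarrow>
     (\<exists>f. bij_betw f (verts G) (verts H) \<and> edges H = (\<lambda>e. f ` e) ` edges G)"

definition hypercube :: "nat \<Rightarrow> nat set ugraph" where
  "hypercube n =
     (Pow {1..n}, {{X, Y} | X Y. X \<subseteq> {1..n} \<and> Y \<subseteq> {1..n} \<and> card (sym_diff X Y) = 1})"

definition vertex_layer :: "nat \<Rightarrow> nat \<Rightarrow> nat set set" where
  "vertex_layer n k = {X \<in> verts (hypercube n). card X = k}"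

text \<open>For \<open>k = 0\<close> the truncated \<open>k - 1\<close> is harmless: no two vertices of layer 0 are adjacent,
  so the star is the single vertex \<open>X\<close>.\<close>

definition down_nbrs :: "nat \<Rightarrow> nat \<Rightarrow> nat set \<Rightarrow> nat set set" where
  "down_nbrs n k X = {Y \<in> vertex_layer n (k - 1). {X, Y} \<in> edges (hypercube n)}"

definition down_star :: "nat \<Rightarrow> nat \<Rightarrow> nat set \<Rightarrow> nat set ugraph" where
  "down_star n k X = (insert X (down_nbrs n k X), {{X, Y} | Y. Y \<in> down_nbrs n k X})"

definition down_stars_union :: "nat \<Rightarrow> nat \<Rightarrow> nat set set \<Rightarrow> nat set ugraph" where
  "down_stars_union n k A =
     (\<Union>X\<in>A. verts (down_star n k X), \<Union>X\<in>A. edges (down_star n k X))"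

definition layer_hypergraph :: "nat \<Rightarrow> nat set set \<Rightarrow> nat ugraph" where
  "layer_hypergraph n A = ({1..n}, A)"

definition k_partite :: "nat \<Rightarrow> 'a ugraph \<Rightarrow> bool" where
  "k_partite k H \<longleftrightarrow>
     (\<exists>P :: nat \<Rightarrow> 'a set. disjoint_family_on P {..<k} \<and> (\<Union>i<k. P i) = verts H \<and>
        (\<forall>e \<in> edges H. \<forall>i<k. card (e \<inter> P i) = 1))"

definition has_induced_partite_representation :: "nat \<Rightarrow> 'a ugraph \<Rightarrow> bool" where
  "has_induced_partite_representation k G \<longleftrightarrow>
     (\<exists>n A G'. A \<subseteq> vertex_layer n k \<and> k_partite k (layer_hypergraph n A) \<and>
        subgraph G' (down_stars_union n k A) \<and> induced_subgraph G' (hypercube n) \<and>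
        isomorphic G G')"

definition contains_induced_copy :: "'b ugraph \<Rightarrow> 'a ugraph \<Rightarrow> bool" where
  "contains_induced_copy H G \<longleftrightarrow> (\<exists>G'. induced_subgraph G' H \<and> isomorphic G G')"

definition contains_copy_induced_in :: "'b ugraph \<Rightarrow> 'b ugraph \<Rightarrow> 'a ugraph \<Rightarrow> bool" where
  "contains_copy_induced_in Q H G \<longleftrightarrow>
     (\<exists>G'. subgraph G' H \<and> induced_subgraph G' Q \<and> isomorphic G G')"

text \<open>Both extremal numbers are suprema of finite sets of naturals, hence maxima; only for the
  graph without vertices, which every graph contains, is the set empty and the value 0.
  In \<open>ex_induced\<close> a copy of \<open>G\<close> must be induced in the host subgraph \<open>H\<close>; in
  \<open>ex_cube_induced\<close> it must lie in \<open>H\<close> and be induced in the whole cube. The latter kind of copy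
  is in particular induced in \<open>H\<close>, so \<open>ex_induced n G \<le> ex_cube_induced n G\<close>.\<close>

definition ex_induced :: "nat \<Rightarrow> 'a ugraph \<Rightarrow> nat" where
  "ex_induced n G =
     Sup {card (edges H) | H. subgraph H (hypercube n) \<and> \<not> contains_induced_copy H G}"

definition ex_cube_induced :: "nat \<Rightarrow> 'a ugraph \<Rightarrow> nat" where
  "ex_cube_induced n G =
     Sup {card (edges H) | H. subgraph H (hypercube n) \<and>
            \<not> contains_copy_induced_in (hypercube n) H G}"

end

theory Submission
  imports Defs "HOL-Analysis.Convex"
begin

text \<open>Let \<open>H\<close> be a subgraph of \<open>Q\<^sub>n\<close> of positive density. By convexity, vertices \<open>X\<close> have on average
  a positive proportion of \<open>k\<close>-tuples in \<open>X\<close> all of whose entries \<open>x\<close> give an edge \<open>{X, X - {x}}\<close>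
  of \<open>H\<close>. Sending \<open>X\<close> with such a tuple to the base \<open>S\<close> that remains when the tuple is removed from
  \<open>X\<close> is injective, so some \<open>S\<close> carries a dense \<open>k\<close>-uniform hypergraph of sets \<open>K\<close> such that the
  whole down \<open>k\<close>-star of \<open>S \<union> K\<close> in the directions \<open>K\<close> lies in \<open>H\<close>; no restriction to the middle
  layers is needed. By the theorem of Erdos this hypergraph contains a large complete \<open>k\<close>-partite
  hypergraph, whose classes are disjoint once the few tuples with repetitions are discarded, and
  hence a copy \<open>\<phi>\<close> of the representing one. The map \<open>X \<mapsto> S \<union> \<phi> X\<close> embeds the small cube as a
  subcube, so it preserves inducedness.\<close>

section \<open>Dense sets of tuples\<close>

lemma convex_on_power: "convex_on {0::real..} (\<lambda>x. x ^ k)"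
  by (cases "even k") (auto intro: convex_power_even convex_power_odd convex_on_subset)

lemma card_mult_power_le_sum_power:
  fixes f :: "'a \<Rightarrow> real" and d :: real
  assumes "finite A" and nonneg: "\<And>x. x \<in> A \<Longrightarrow> 0 \<le> f x" and "0 \<le> d"
    and avg: "card A * d \<le> (\<Sum>x\<in>A. f x)"
  shows "card A * d ^ k \<le> (\<Sum>x\<in>A. f x ^ k)"
proof (cases "A = {}")
  case False
  then have card_pos: "real (card A) > 0" using assms(1) by (simp add: card_gt_0_iff)
  have "d ^ k \<le> (\<Sum>x\<in>A. 1 / card A * f x) ^ k"
    using avg card_pos \<open>0 \<le> d\<close>
    by (intro power_mono) (simp_all add: field_simps flip: sum_divide_distrib)
  also have "\<dots> \<le> (\<Sum>x\<in>A. 1 / card A * f x ^ k)"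
    using convex_on_sum[OF \<open>finite A\<close> False convex_on_power, of "\<lambda>x. 1 / card A" f k]
      card_pos nonneg by simp
  also have "\<dots> = (\<Sum>x\<in>A. f x ^ k) / card A"
    by (simp flip: sum_divide_distrib)
  finally show ?thesis using card_pos by (simp add: field_simps)
qed simp

lemma exists_ge_average:
  fixes f :: "'a \<Rightarrow> real" and d :: real
  assumes "finite A" "A \<noteq> {}" and "card A * d \<le> (\<Sum>x\<in>A. f x)"
  shows "\<exists>x\<in>A. d \<le> f x"
proof (rule ccontr)
  assume "\<not> ?thesis"
  then have "(\<Sum>x\<in>A. f x) < card A * d"
    using assms(1,2) by (intro sum_bounded_above_strict) (auto simp: card_gt_0_iff not_le)
  then show False using assms(3) by simp
qed

definition tuples :: "nat \<Rightarrow> 'a set \<Rightarrow> 'a list set" where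
  "tuples k V = {xs. set xs \<subseteq> V \<and> length xs = k}"

lemma finite_tuples: "finite V \<Longrightarrow> finite (tuples k V)"
  by (simp add: tuples_def finite_lists_length_eq)

lemma card_tuples: "finite V \<Longrightarrow> card (tuples k V) = card V ^ k"
  by (simp add: tuples_def card_lists_length_eq)

lemma card_eq_sum_card_extensions:
  assumes "finite V" and E: "E \<subseteq> tuples (Suc k) V"
  shows "card E = (\<Sum>xs\<in>tuples k V. card {v \<in> V. v # xs \<in> E})"
proof -
  let ?P = "SIGMA xs:tuples k V. {v \<in> V. v # xs \<in> E}"
  have "bij_betw (\<lambda>(xs, v). v # xs) ?P E"
  proof (rule bij_betw_imageI)
    show "(\<lambda>(xs, v). v # xs) ` ?P = E"
    proof (intro equalityI subsetI)
      fix ys assume ys: "ys \<in> E"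
      then obtain v xs where "ys = v # xs" "v \<in> V" "xs \<in> tuples k V"
        using E by (cases ys) (auto simp: tuples_def)
      then show "ys \<in> (\<lambda>(xs, v). v # xs) ` ?P" using ys by force
    qed auto
  qed (auto simp: inj_on_def)
  from bij_betw_same_card[OF this] show ?thesis
    using \<open>finite V\<close> by (simp add: finite_tuples)
qed

definition nondistinct_tuples :: "nat \<Rightarrow> 'a set \<Rightarrow> 'a list set" where
  "nondistinct_tuples k V = {xs \<in> tuples k V. \<not> distinct xs}"

lemma card_nondistinct_tuples_le:
  assumes "finite V"
  shows "card (nondistinct_tuples k V) * card V \<le> k\<^sup>2 * card V ^ k"
proof (induction k)
  case 0
  show ?case by (simp add: nondistinct_tuples_def tuples_def)
next
  case (Suc k)
  define n where "n = card V"
  have extensions_le: "card {v \<in> V. v # xs \<in> nondistinct_tuples (Suc k) V}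
      \<le> k + (if distinct xs then 0 else n)"
    if "xs \<in> tuples k V" for xs
  proof (cases "distinct xs")
    case True
    then have "card {v \<in> V. v # xs \<in> nondistinct_tuples (Suc k) V} \<le> card (set xs)"
      by (intro card_mono) (auto simp: nondistinct_tuples_def)
    then show ?thesis using that True card_length[of xs] by (simp add: tuples_def)
  next
    case False
    then show ?thesis
      using card_mono[of V "{v \<in> V. v # xs \<in> nondistinct_tuples (Suc k) V}"] \<open>finite V\<close>
      by (auto simp: n_def)
  qed
  have "card (nondistinct_tuples (Suc k) V) =
      (\<Sum>xs\<in>tuples k V. card {v \<in> V. v # xs \<in> nondistinct_tuples (Suc k) V})"
    using \<open>finite V\<close> by (intro card_eq_sum_card_extensions) (auto simp: nondistinct_tuples_def)
  also have "\<dots> \<le> (\<Sum>xs\<in>tuples k V. k + (if distinct xs then 0 else n))"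
    by (intro sum_mono extensions_le)
  also have "\<dots> = k * n ^ k + card (nondistinct_tuples k V) * n"
    using \<open>finite V\<close>
    by (simp add: sum.distrib sum.If_cases card_tuples finite_tuples nondistinct_tuples_def
        n_def Int_def)
  also have "\<dots> \<le> k * n ^ k + k\<^sup>2 * n ^ k"
    using Suc by (simp add: n_def)
  also have "\<dots> \<le> (Suc k)\<^sup>2 * n ^ k"
    by (simp add: power2_eq_square algebra_simps)
  finally show ?case by (simp add: n_def mult.commute)
qed

lemma eventually_card_nondistinct_tuples_le:
  fixes \<epsilon> :: real
  assumes "\<epsilon> > 0"
  shows "\<forall>\<^sub>F n in sequentially. \<forall>V :: 'a set. finite V \<and> card V = n \<longrightarrow>
    card (nondistinct_tuples k V) \<le> \<epsilon> * n ^ k"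
  using eventually_ge_at_top[of "nat \<lceil>k\<^sup>2 / \<epsilon>\<rceil>"] eventually_gt_at_top[of 0]
proof eventually_elim
  case (elim n)
  then have k_le: "k\<^sup>2 \<le> \<epsilon> * n" using \<open>\<epsilon> > 0\<close> by (simp add: nat_ceiling_le_eq field_simps)
  show ?case
  proof (intro allI impI, elim conjE)
    fix V :: "'a set" assume V: "finite V" "card V = n"
    have "real (card (nondistinct_tuples k V)) * n \<le> k\<^sup>2 * real n ^ k"
      using card_nondistinct_tuples_le[OF V(1), of k] V(2)
      by (simp flip: of_nat_power of_nat_mult)
    also have "\<dots> \<le> \<epsilon> * n * real n ^ k"
      using k_le by (intro mult_right_mono) auto
    finally show "card (nondistinct_tuples k V) \<le> \<epsilon> * n ^ k"
      using elim by simp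
  qed
qed

definition common_link :: "nat \<Rightarrow> 'a set \<Rightarrow> 'a list set \<Rightarrow> 'a set \<Rightarrow> 'a list set" where
  "common_link k V E U = {xs \<in> tuples k V. \<forall>v\<in>U. v # xs \<in> E}"

lemma card_common_link_le:
  assumes "finite V"
  shows "card (common_link k V E U) \<le> card V ^ k"
  unfolding card_tuples[OF assms, symmetric]
  by (intro card_mono) (auto simp: common_link_def finite_tuples assms)

lemma sum_card_common_link_ge:
  fixes \<delta> :: real
  assumes V: "finite V" and E: "E \<subseteq> tuples (Suc k) V" and "0 \<le> \<delta>"
    and dens: "\<delta> * card V ^ Suc k \<le> card E"
  shows "card V ^ t * (\<delta> ^ t * card V ^ k) \<le> (\<Sum>vs\<in>tuples t V. card (common_link k V E (set vs)))"
proof -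
  define D where "D xs = {v \<in> V. v # xs \<in> E}" for xs
  have "card (tuples k V) * (\<delta> * card V) \<le> (\<Sum>xs\<in>tuples k V. real (card (D xs)))"
    using dens V by (simp add: card_eq_sum_card_extensions[OF V E] D_def card_tuples algebra_simps)
  then have "card (tuples k V) * (\<delta> * card V) ^ t \<le> (\<Sum>xs\<in>tuples k V. real (card (D xs)) ^ t)"
    using assms by (intro card_mult_power_le_sum_power) (auto simp: finite_tuples)
  also have "\<dots> = real (\<Sum>xs\<in>tuples k V. card {vs \<in> tuples t V. set vs \<subseteq> D xs})"
  proof -
    have "{vs \<in> tuples t V. set vs \<subseteq> D xs} = tuples t (D xs)" for xs
      by (auto simp: tuples_def D_def)
    moreover have "finite (D xs)" for xs using V by (simp add: D_def)
    ultimately show ?thesis by (simp add: card_tuples)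
  qed
  also have "(\<Sum>xs\<in>tuples k V. card {vs \<in> tuples t V. set vs \<subseteq> D xs}) =
      (\<Sum>vs\<in>tuples t V. card {xs \<in> tuples k V. set vs \<subseteq> D xs})"
    using V by (intro sum_multicount_gen) (auto simp: finite_tuples)
  also have "\<dots> = (\<Sum>vs\<in>tuples t V. card (common_link k V E (set vs)))"
    by (intro sum.cong arg_cong[where f = card]) (auto simp: common_link_def D_def tuples_def)
  finally show ?thesis
    using V by (simp add: card_tuples power_mult_distrib mult_ac)
qed

lemma dense_common_link_exists:
  fixes \<delta> :: real
  assumes V: "finite V" "V \<noteq> {}" and E: "E \<subseteq> tuples (Suc k) V" and "0 < \<delta>"
    and dens: "\<delta> * card V ^ Suc k \<le> card E"
    and few: "card (nondistinct_tuples t V) \<le> \<delta> ^ t / 2 * card V ^ t"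
  obtains U where "card U = t" "\<delta> ^ t / 2 * card V ^ k \<le> card (common_link k V E U)"
proof -
  define n where "n = real (card V)"
  \<comment> \<open>Entries of a tuple with a repetition do not form a \<open>t\<close>-set; the penalty, at least the size of
    any link, keeps the average from selecting such a tuple.\<close>
  define penalty where "penalty vs = (if distinct vs then 0 else n ^ k)" for vs :: "'a list"
  have "n > 0" using V by (simp add: n_def card_gt_0_iff)
  have "(\<Sum>vs\<in>tuples t V. penalty vs) = card (nondistinct_tuples t V) * n ^ k"
    using V(1) by (simp add: penalty_def sum.If_cases finite_tuples nondistinct_tuples_def Int_def)
  also have "\<dots> \<le> \<delta> ^ t / 2 * n ^ t * n ^ k"
    using few \<open>n > 0\<close> by (intro mult_right_mono) (simp_all add: n_def)
  finally have "card (tuples t V) * (\<delta> ^ t / 2 * n ^ k) \<le>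
      (\<Sum>vs\<in>tuples t V. card (common_link k V E (set vs)) - penalty vs)"
    using sum_card_common_link_ge[OF V(1) E _ dens, of t] \<open>0 < \<delta>\<close> V
    by (simp add: sum_subtractf card_tuples n_def algebra_simps)
  moreover have "tuples t V \<noteq> {}"
    using card_tuples[OF V(1), of t] V by auto
  ultimately obtain vs where vs: "vs \<in> tuples t V"
    and link: "\<delta> ^ t / 2 * n ^ k \<le> card (common_link k V E (set vs)) - penalty vs"
    using exists_ge_average[OF finite_tuples[OF V(1)]] by blast
  have "distinct vs"
  proof (rule ccontr)
    assume "\<not> distinct vs"
    moreover have "card (common_link k V E (set vs)) \<le> n ^ k"
      using card_common_link_le[OF V(1)] by (simp add: n_def flip: of_nat_power)
    moreover have "0 < \<delta> ^ t / 2 * n ^ k" using \<open>0 < \<delta>\<close> \<open>n > 0\<close> by simp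
    ultimately show False using link by (simp add: penalty_def)
  qed
  then show thesis
    using vs link that[of "set vs"] by (simp add: penalty_def n_def tuples_def distinct_card)
qed

text \<open>A set \<open>E\<close> of \<open>k\<close>-tuples is an ordered \<open>k\<close>-uniform hypergraph; a grid in it is a complete
  \<open>k\<close>-partite subhypergraph with classes of size \<open>t\<close>, which may overlap. For \<open>t = 0\<close> the classes
  can be infinite, since then \<open>card\<close> is 0.\<close>

definition contains_grid :: "nat \<Rightarrow> nat \<Rightarrow> 'a list set \<Rightarrow> bool" where
  "contains_grid k t E \<longleftrightarrow> (\<exists>Bs \<in> tuples k {B. card B = t}. listset Bs \<subseteq> E)"

lemma contains_grid_common_link:
  assumes "contains_grid k t (common_link k V E U)" "card U = t"
  shows "contains_grid (Suc k) t E"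
proof -
  obtain Bs where Bs: "Bs \<in> tuples k {B. card B = t}" "listset Bs \<subseteq> common_link k V E U"
    using assms(1) by (auto simp: contains_grid_def)
  then have "listset (U # Bs) \<subseteq> E" by (auto simp: set_Cons_def common_link_def)
  moreover have "U # Bs \<in> tuples (Suc k) {B. card B = t}"
    using Bs assms(2) by (simp add: tuples_def)
  ultimately show ?thesis unfolding contains_grid_def by blast
qed

theorem eventually_dense_contains_grid:
  fixes \<delta> :: real
  assumes "\<delta> > 0"
  shows "\<forall>\<^sub>F n in sequentially. \<forall>(V :: 'a set) E. finite V \<and> card V = n \<and>
    E \<subseteq> tuples k V \<and> \<delta> * n ^ k \<le> card E \<longrightarrow> contains_grid k t E"
  using assms
proof (induction k arbitrary: \<delta>)
  case 0
  have "contains_grid 0 t E" if "E \<subseteq> tuples 0 V" "\<delta> \<le> card E" for E and V :: "'a set"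
  proof -
    have "E \<noteq> {}" using that 0 by auto
    then have "[] \<in> E" using that by (auto simp: tuples_def)
    then show ?thesis by (simp add: contains_grid_def tuples_def)
  qed
  then show ?case by (intro always_eventually) auto
next
  case (Suc k)
  then have "\<delta> ^ t / 2 > 0" by simp
  from Suc.IH[OF this] eventually_card_nondistinct_tuples_le[where 'a = 'a and k = t, OF this]
    eventually_gt_at_top[of 0]
  show ?case
  proof eventually_elim
    case (elim n)
    show ?case
    proof (intro allI impI, elim conjE)
      fix V :: "'a set" and E
      assume V: "finite V" "card V = n" and E: "E \<subseteq> tuples (Suc k) V" "\<delta> * n ^ Suc k \<le> card E"
      have "V \<noteq> {}" using V elim(3) by auto
      then obtain U where U: "card U = t" "\<delta> ^ t / 2 * n ^ k \<le> card (common_link k V E U)"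
        using dense_common_link_exists[of V E k \<delta> t] V E elim(2) Suc.prems by blast
      moreover have "common_link k V E U \<subseteq> tuples k V" by (auto simp: common_link_def)
      ultimately have "contains_grid k t (common_link k V E U)" using elim(1) V by blast
      then show "contains_grid (Suc k) t E" using U(1) by (rule contains_grid_common_link)
    qed
  qed
qed

lemma in_listset_iff: "xs \<in> listset Bs \<longleftrightarrow> list_all2 (\<in>) xs Bs"
  by (induction Bs arbitrary: xs) (auto simp: set_Cons_def list_all2_Cons2)

lemma listset_update:
  assumes "xs \<in> listset Bs" "i < length Bs" "x \<in> Bs ! i"
  shows "xs[i := x] \<in> listset Bs"
  using assms by (auto simp: in_listset_iff list_all2_conv_all_nth nth_list_update)

lemma listset_nonempty:
  assumes "{} \<notin> set Bs"
  obtains xs where "xs \<in> listset Bs"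
proof -
  have "map (\<lambda>B. SOME x. x \<in> B) Bs \<in> listset Bs"
    using assms by (auto simp: in_listset_iff list_all2_conv_all_nth some_in_eq) (metis nth_mem)
  then show thesis by (rule that)
qed

lemma subset_if_listset_subset_tuples:
  assumes "listset Bs \<subseteq> tuples k W" "{} \<notin> set Bs" "B \<in> set Bs"
  shows "B \<subseteq> W"
proof
  fix x assume "x \<in> B"
  obtain i where i: "i < length Bs" "B = Bs ! i" using assms(3) by (auto simp: in_set_conv_nth)
  obtain xs where xs: "xs \<in> listset Bs" using assms(2) by (rule listset_nonempty)
  then have "xs[i := x] \<in> listset Bs" using i \<open>x \<in> B\<close> by (blast intro: listset_update)
  moreover have "x \<in> set (xs[i := x])"
    using xs i by (simp add: in_listset_iff list_all2_lengthD set_update_memI)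
  ultimately show "x \<in> W" using assms(1) by (auto simp: tuples_def)
qed

lemma disjoint_family_on_if_listset_distinct:
  assumes "\<And>xs. xs \<in> listset Bs \<Longrightarrow> distinct xs" "{} \<notin> set Bs"
  shows "disjoint_family_on ((!) Bs) {..<length Bs}"
proof -
  have False if ij: "i < length Bs" "j < length Bs" "i \<noteq> j"
    and x: "x \<in> Bs ! i" "x \<in> Bs ! j" for i j x
  proof -
    obtain xs where xs: "xs \<in> listset Bs" using assms(2) by (rule listset_nonempty)
    define ys where "ys = xs[i := x, j := x]"
    have "ys \<in> listset Bs" using xs x ij by (simp add: ys_def listset_update)
    then have "distinct ys" "length ys = length Bs"
      by (auto simp: assms(1) in_listset_iff list_all2_lengthD)
    moreover have "ys ! i = ys ! j"
      using xs ij by (simp add: ys_def in_listset_iff list_all2_lengthD)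
    ultimately show False using ij by (simp add: nth_eq_iff_index_eq)
  qed
  then show ?thesis by (auto simp: disjoint_family_on_def)
qed

lemma eventually_dense_contains_disjoint_grid:
  fixes \<delta> :: real
  assumes "\<delta> > 0" "t > 0"
  shows "\<forall>\<^sub>F n in sequentially. \<forall>(V :: 'a set) E. finite V \<and> card V = n \<and>
    E \<subseteq> tuples k V \<and> \<delta> * n ^ k \<le> card E \<longrightarrow>
    (\<exists>Bs \<in> tuples k {B. card B = t}. listset Bs \<subseteq> E \<and> disjoint_family_on ((!) Bs) {..<k})"
proof -
  have "\<delta> / 2 > 0" using assms by simp
  from eventually_dense_contains_grid[where 'a = 'a and k = k and t = t, OF this]
    eventually_card_nondistinct_tuples_le[where 'a = 'a and k = k, OF this]
  show ?thesis
  proof eventually_elim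
    case (elim n)
    show ?case
    proof (intro allI impI, elim conjE)
      fix V :: "'a set" and E
      assume V: "finite V" "card V = n" and E: "E \<subseteq> tuples k V" "\<delta> * n ^ k \<le> card E"
      define D where "D = {xs \<in> E. distinct xs}"
      have "card E \<le> card (D \<union> nondistinct_tuples k V)"
        using V(1) E(1) by (intro card_mono)
          (auto simp: D_def nondistinct_tuples_def finite_tuples intro: finite_subset)
      also have "\<dots> \<le> card D + card (nondistinct_tuples k V)"
        by (rule card_Un_le)
      finally have "\<delta> / 2 * n ^ k \<le> card D"
        using E(2) elim(2) V by fastforce
      moreover have "D \<subseteq> tuples k V" using E(1) by (auto simp: D_def)
      ultimately have "contains_grid k t D" using elim(1) V by blast
      then obtain Bs where Bs: "Bs \<in> tuples k {B. card B = t}" "listset Bs \<subseteq> D"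
        by (auto simp: contains_grid_def)
      then have "{} \<notin> set Bs" using \<open>t > 0\<close> by (auto simp: tuples_def)
      then have "disjoint_family_on ((!) Bs) {..<length Bs}"
        using Bs(2) by (intro disjoint_family_on_if_listset_distinct) (auto simp: D_def)
      then show "\<exists>Bs \<in> tuples k {B. card B = t}.
          listset Bs \<subseteq> E \<and> disjoint_family_on ((!) Bs) {..<k}"
        using Bs by (auto simp: D_def tuples_def)
    qed
  qed
qed

section \<open>Embedding partite hypergraphs into grids\<close>

lemma inj_on_glue_disjoint_families:
  assumes P: "disjoint_family_on P I" and B: "disjoint_family_on B I"
    and fin: "\<And>i. i \<in> I \<Longrightarrow> finite (P i) \<and> finite (B i) \<and> card (P i) \<le> card (B i)"
  obtains \<phi> where "inj_on \<phi> (\<Union>i\<in>I. P i)" "\<And>i. i \<in> I \<Longrightarrow> \<phi> ` P i \<subseteq> B i"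
proof -
  have "\<forall>i\<in>I. \<exists>f. f ` P i \<subseteq> B i \<and> inj_on f (P i)"
    using fin card_le_inj by blast
  then obtain f where f: "\<And>i. i \<in> I \<Longrightarrow> f i ` P i \<subseteq> B i \<and> inj_on (f i) (P i)"
    by metis
  define part where "part p = (THE i. i \<in> I \<and> p \<in> P i)" for p
  have part: "part p = i" if "i \<in> I" "p \<in> P i" for i p
    unfolding part_def using that P by (intro the_equality) (auto simp: disjoint_family_on_def)
  define \<phi> where "\<phi> p = f (part p) p" for p
  have image: "\<phi> ` P i \<subseteq> B i" if "i \<in> I" for i
    using that f part by (force simp: \<phi>_def)
  moreover have "inj_on \<phi> (\<Union>i\<in>I. P i)"
  proof (rule inj_onI)
    fix p q assume "p \<in> (\<Union>i\<in>I. P i)" "q \<in> (\<Union>i\<in>I. P i)" and eq: "\<phi> p = \<phi> q"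
    then obtain i j where ij: "i \<in> I" "p \<in> P i" "j \<in> I" "q \<in> P j" by auto
    then have "\<phi> p \<in> B i" "\<phi> q \<in> B j" using image by blast+
    then have "i = j" using B ij eq by (auto simp: disjoint_family_on_def)
    then show "p = q" using ij eq f part by (auto simp: \<phi>_def inj_on_def)
  qed
  ultimately show thesis using that by blast
qed

lemma partite_edge_image_in_listset:
  assumes a: "a \<subseteq> (\<Union>i<k. P i)" "\<And>i. i < k \<Longrightarrow> card (a \<inter> P i) = 1"
    and \<phi>: "\<And>i. i < k \<Longrightarrow> \<phi> ` P i \<subseteq> Bs ! i" and "length Bs = k"
  obtains xs where "xs \<in> listset Bs" "set xs = \<phi> ` a"
proof -
  have "\<forall>i. \<exists>x. i < k \<longrightarrow> a \<inter> P i = {x}"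
    using a(2) by (auto simp: card_1_singleton_iff)
  then obtain c where c: "\<And>i. i < k \<Longrightarrow> a \<inter> P i = {c i}" by metis
  have "a = (\<Union>i<k. a \<inter> P i)" using a(1) by auto
  also have "\<dots> = c ` {..<k}" using c by auto
  finally have "set (map (\<phi> \<circ> c) [0..<k]) = \<phi> ` a"
    by (simp add: image_image lessThan_atLeast0)
  moreover have "map (\<phi> \<circ> c) [0..<k] \<in> listset Bs"
    using c \<phi> \<open>length Bs = k\<close> by (fastforce simp: in_listset_iff list_all2_conv_all_nth)
  ultimately show thesis by (metis that)
qed

lemma k_partite_embeds_in_grid:
  assumes "k_partite k H" and H: "finite (verts H)" "\<And>e. e \<in> edges H \<Longrightarrow> e \<subseteq> verts H"
    and t: "card (verts H) < t"
    and Bs: "Bs \<in> tuples k {B. card B = t}" "disjoint_family_on ((!) Bs) {..<k}"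
  obtains \<phi> where "inj_on \<phi> (verts H)" "\<phi> ` verts H \<subseteq> \<Union>(set Bs)"
    "\<And>e. e \<in> edges H \<Longrightarrow> \<exists>xs\<in>listset Bs. set xs = \<phi> ` e"
proof -
  obtain P where P: "disjoint_family_on P {..<k}" and P_union: "(\<Union>i<k. P i) = verts H"
    and P_card: "\<And>e i. e \<in> edges H \<Longrightarrow> i < k \<Longrightarrow> card (e \<inter> P i) = 1"
    using assms(1) unfolding k_partite_def by auto
  have Bs_length: "length Bs = k" and Bs_card: "\<And>i. i < k \<Longrightarrow> card (Bs ! i) = t"
    using Bs(1) by (auto simp: tuples_def dest!: nth_mem)
  have "finite (P i) \<and> finite (Bs ! i) \<and> card (P i) \<le> card (Bs ! i)" if "i \<in> {..<k}" for i
  proof -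
    have "P i \<subseteq> verts H" using P_union that by auto
    then show ?thesis
      using H(1) t card_mono[of "verts H" "P i"] Bs_card[of i] that card_ge_0_finite[of "Bs ! i"]
      by (auto intro: finite_subset)
  qed
  from inj_on_glue_disjoint_families[OF P Bs(2) this]
  obtain \<phi> where \<phi>: "inj_on \<phi> (verts H)" "\<And>i. i < k \<Longrightarrow> \<phi> ` P i \<subseteq> Bs ! i"
    unfolding P_union by auto
  show thesis
  proof (rule that[OF \<phi>(1)])
    have "\<phi> ` verts H = (\<Union>i<k. \<phi> ` P i)" by (simp add: image_UN flip: P_union)
    also have "\<dots> \<subseteq> (\<Union>i<k. Bs ! i)" using \<phi>(2) by (intro UN_mono) auto
    also have "\<dots> \<subseteq> \<Union>(set Bs)" using Bs_length by (auto intro: nth_mem)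
    finally show "\<phi> ` verts H \<subseteq> \<Union>(set Bs)" .
    show "\<exists>xs\<in>listset Bs. set xs = \<phi> ` e" if e: "e \<in> edges H" for e
    proof -
      have "e \<subseteq> (\<Union>i<k. P i)" using H(2)[OF e] P_union by simp
      then obtain xs where "xs \<in> listset Bs" "set xs = \<phi> ` e"
        using P_card[OF e] \<phi>(2) Bs_length by (rule partite_edge_image_in_listset)
      then show ?thesis by blast
    qed
  qed
qed

section \<open>Induced embeddings\<close>

definition graph_image :: "('a \<Rightarrow> 'b) \<Rightarrow> 'a ugraph \<Rightarrow> 'b ugraph" where
  "graph_image f G = (f ` verts G, (\<lambda>e. f ` e) ` edges G)"

definition induced_embedding :: "('a \<Rightarrow> 'b) \<Rightarrow> 'a ugraph \<Rightarrow> 'b ugraph \<Rightarrow> bool" where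
  "induced_embedding f Q Q' \<longleftrightarrow> inj_on f (verts Q) \<and> f ` verts Q \<subseteq> verts Q' \<and>
     (\<forall>u\<in>verts Q. \<forall>v\<in>verts Q. {f u, f v} \<in> edges Q' \<longleftrightarrow> {u, v} \<in> edges Q)"

lemma simple_graph_edgeE:
  assumes "simple_graph G" "e \<in> edges G"
  obtains u v where "u \<in> verts G" "v \<in> verts G" "u \<noteq> v" "e = {u, v}"
  using assms by (fastforce simp: simple_graph_def card_2_iff)

lemma finite_edges_if_simple_graph:
  assumes "simple_graph G"
  shows "finite (edges G)"
  using assms finite_subset[of "edges G" "Pow (verts G)"] by (auto simp: simple_graph_def)

lemma simple_graph_graph_image:
  assumes "simple_graph G" "inj_on f (verts G)"
  shows "simple_graph (graph_image f G)"
  using assms unfolding simple_graph_def graph_image_def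
  by (auto simp: card_image[OF inj_on_subset])

lemma isomorphic_graph_image_trans:
  assumes "isomorphic G G'" "inj_on f (verts G')"
  shows "isomorphic G (graph_image f G')"
proof -
  obtain g where g: "bij_betw g (verts G) (verts G')" "edges G' = (\<lambda>e. g ` e) ` edges G"
    using assms(1) by (auto simp: isomorphic_def)
  have "bij_betw (f \<circ> g) (verts G) (verts (graph_image f G'))"
    using g(1) assms(2) by (intro bij_betw_trans[OF g(1)]) (simp add: bij_betw_def graph_image_def)
  moreover have "edges (graph_image f G') = (\<lambda>e. (f \<circ> g) ` e) ` edges G"
    by (simp add: g(2) graph_image_def image_image image_comp)
  ultimately show ?thesis unfolding isomorphic_def by blast
qed

lemma induced_subgraph_graph_image:
  assumes f: "induced_embedding f Q Q'" and Q': "simple_graph Q'" and G: "induced_subgraph G Q"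
  shows "induced_subgraph (graph_image f G) Q'"
proof -
  have G_simple: "simple_graph G" and G_verts: "verts G \<subseteq> verts Q"
    and G_edges: "edges G = {e \<in> edges Q. e \<subseteq> verts G}"
    using G by (simp_all add: induced_subgraph_def subgraph_def)
  have edge_iff: "{f u, f v} \<in> edges Q' \<longleftrightarrow> {u, v} \<in> edges G"
    if "u \<in> verts G" "v \<in> verts G" for u v
    using that f G_verts by (subst G_edges) (auto simp: induced_embedding_def)
  have "edges (graph_image f G) = {e \<in> edges Q'. e \<subseteq> verts (graph_image f G)}"
  proof (intro equalityI subsetI)
    fix e assume "e \<in> edges (graph_image f G)"
    then obtain d where d: "d \<in> edges G" "e = f ` d" by (auto simp: graph_image_def)
    then obtain u v where "u \<in> verts G" "v \<in> verts G" "d = {u, v}"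
      using simple_graph_edgeE[OF G_simple] by metis
    then show "e \<in> {e \<in> edges Q'. e \<subseteq> verts (graph_image f G)}"
      using d edge_iff by (auto simp: graph_image_def)
  next
    fix e assume "e \<in> {e \<in> edges Q'. e \<subseteq> verts (graph_image f G)}"
    then have e: "e \<in> edges Q'" "e \<subseteq> f ` verts G" by (auto simp: graph_image_def)
    from Q' e(1) obtain x y where "e = {x, y}" by (rule simple_graph_edgeE)
    with e(2) obtain u v where uv: "u \<in> verts G" "v \<in> verts G" "e = f ` {u, v}" by auto
    then have "{u, v} \<in> edges G" using e(1) edge_iff by auto
    then show "e \<in> edges (graph_image f G)"
      unfolding graph_image_def snd_conv uv(3) by (rule imageI)
  qed
  moreover have "inj_on f (verts G)" "f ` verts G \<subseteq> verts Q'"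
    using f G_verts by (auto simp: induced_embedding_def intro: inj_on_subset)
  ultimately show ?thesis
    using simple_graph_graph_image[OF G_simple, of f]
    unfolding induced_subgraph_def subgraph_def by (auto simp: graph_image_def)
qed

lemma contains_copy_induced_in_if_embedding:
  assumes f: "induced_embedding f Q Q'" and "simple_graph Q'"
    and G': "induced_subgraph G' Q" "isomorphic G G'"
    and H: "f ` verts G' \<subseteq> verts H" "\<And>e. e \<in> edges G' \<Longrightarrow> f ` e \<in> edges H"
  shows "contains_copy_induced_in Q' H G"
proof -
  have image: "induced_subgraph (graph_image f G') Q'"
    using assms by (intro induced_subgraph_graph_image)
  moreover have "edges (graph_image f G') \<subseteq> edges H"
    using H(2) by (auto simp: graph_image_def)
  ultimately have "subgraph (graph_image f G') H"
    using H(1) by (simp add: induced_subgraph_def subgraph_def) (simp add: graph_image_def)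
  moreover have "inj_on f (verts G')"
    using f G'(1) by (auto simp: induced_embedding_def induced_subgraph_def subgraph_def
        intro: inj_on_subset)
  ultimately show ?thesis
    using image isomorphic_graph_image_trans[OF G'(2)]
    unfolding contains_copy_induced_in_def by blast
qed

lemma contains_induced_copy_if_contains_copy_induced_in:
  assumes "subgraph H Q" "contains_copy_induced_in Q H G"
  shows "contains_induced_copy H G"
proof -
  obtain G' where G': "subgraph G' H" "induced_subgraph G' Q" "isomorphic G G'"
    using assms(2) by (auto simp: contains_copy_induced_in_def)
  have "edges G' \<subseteq> edges H" "edges H \<subseteq> edges Q"
    and "edges G' = {e \<in> edges Q. e \<subseteq> verts G'}"
    using G' assms(1) by (simp_all add: subgraph_def induced_subgraph_def)
  then have "edges G' = {e \<in> edges H. e \<subseteq> verts G'}" by blast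
  then show ?thesis
    using G' unfolding contains_induced_copy_def induced_subgraph_def by blast
qed

section \<open>The hypercube and its down stars\<close>

lemma hypercube_edge_iff:
  assumes "X \<subseteq> {1..n}" "Y \<subseteq> {1..n}"
  shows "{X, Y} \<in> edges (hypercube n) \<longleftrightarrow> card (sym_diff X Y) = 1"
  using assms by (auto simp: hypercube_def doubleton_eq_iff Un_commute)

lemma verts_hypercube: "verts (hypercube n) = Pow {1..n}"
  by (simp add: hypercube_def)

lemma in_vertex_layer_iff: "X \<in> vertex_layer n k \<longleftrightarrow> X \<subseteq> {1..n} \<and> card X = k"
  by (simp add: vertex_layer_def verts_hypercube)

lemma hypercube_edgeI:
  assumes "X \<subseteq> {1..n}" "x \<in> X"
  shows "{X, X - {x}} \<in> edges (hypercube n)"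
proof -
  have "sym_diff X (X - {x}) = {x}" using assms by auto
  then show ?thesis using assms by (subst hypercube_edge_iff) auto
qed

lemma hypercube_edgeE:
  assumes "e \<in> edges (hypercube n)"
  obtains X x where "X \<subseteq> {1..n}" "x \<in> X" "e = {X, X - {x}}"
proof -
  obtain X Y x where XY: "X \<subseteq> {1..n}" "Y \<subseteq> {1..n}" "e = {X, Y}" and x: "sym_diff X Y = {x}"
    using assms by (auto simp: hypercube_def card_1_singleton_iff)
  then consider "x \<in> X" "x \<notin> Y" | "x \<in> Y" "x \<notin> X" by auto
  then show thesis
  proof cases
    case 1
    then have "Y = X - {x}" using x by auto
    then show thesis using 1 XY that by blast
  next
    case 2
    moreover have "sym_diff Y X = {x}" using x by (simp add: Un_commute)
    ultimately have "X = Y - {x}" by auto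
    moreover have "e = {Y, X}" using XY(3) by auto
    ultimately show thesis using 2 XY(2) that by blast
  qed
qed

lemma simple_graph_hypercube: "simple_graph (hypercube n)"
proof -
  have "e \<subseteq> Pow {1..n} \<and> card e = 2" if "e \<in> edges (hypercube n)" for e
    using that by (elim hypercube_edgeE) (auto simp: card_2_iff)
  then show ?thesis by (simp add: simple_graph_def verts_hypercube)
qed

definition subcube_map :: "'b set \<Rightarrow> ('a \<Rightarrow> 'b) \<Rightarrow> 'a set \<Rightarrow> 'b set" where
  "subcube_map S \<phi> X = S \<union> \<phi> ` X"

lemma subcube_map_remove:
  assumes "inj_on \<phi> A" "\<phi> ` A \<inter> S = {}" "X \<subseteq> A" "x \<in> X"
  shows "subcube_map S \<phi> (X - {x}) = subcube_map S \<phi> X - {\<phi> x}"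
proof -
  have "\<phi> ` (X - {x}) = \<phi> ` X - {\<phi> x}"
    using inj_on_image_set_diff[OF assms(1), of X "{x}"] assms(3,4) by (simp add: subset_iff)
  moreover have "\<phi> x \<notin> S" using assms(2-4) by blast
  ultimately show ?thesis by (auto simp: subcube_map_def)
qed

lemma card_sym_diff_subcube_map:
  assumes "inj_on \<phi> A" "\<phi> ` A \<inter> S = {}" "X \<subseteq> A" "Y \<subseteq> A"
  shows "card (sym_diff (subcube_map S \<phi> X) (subcube_map S \<phi> Y)) = card (sym_diff X Y)"
proof -
  have "sym_diff (subcube_map S \<phi> X) (subcube_map S \<phi> Y) = \<phi> ` X - \<phi> ` Y \<union> (\<phi> ` Y - \<phi> ` X)"
    using assms(2-4) by (auto simp: subcube_map_def)
  also have "\<dots> = \<phi> ` sym_diff X Y"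
    using assms(3,4)
    by (simp add: image_Un inj_on_image_set_diff[OF assms(1)] subset_trans[OF Diff_subset])
  finally show ?thesis
    using card_image[OF inj_on_subset[OF assms(1), of "sym_diff X Y"]] assms(3,4) by auto
qed

lemma induced_embedding_subcube_map:
  assumes S: "S \<subseteq> {1..n}" and \<phi>: "inj_on \<phi> {1..m}" "\<phi> ` {1..m} \<subseteq> {1..n} - S"
  shows "induced_embedding (subcube_map S \<phi>) (hypercube m) (hypercube n)"
proof -
  have image: "subcube_map S \<phi> X \<subseteq> {1..n}" if "X \<subseteq> {1..m}" for X
    unfolding subcube_map_def using that S \<phi>(2) by blast
  have card_eq: "card (sym_diff (subcube_map S \<phi> X) (subcube_map S \<phi> Y)) = card (sym_diff X Y)"
    if "X \<subseteq> {1..m}" "Y \<subseteq> {1..m}" for X Y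
    using that \<phi> by (intro card_sym_diff_subcube_map) auto
  have "inj_on (subcube_map S \<phi>) (Pow {1..m})"
  proof (rule inj_onI)
    fix X Y assume XY: "X \<in> Pow {1..m}" "Y \<in> Pow {1..m}" "subcube_map S \<phi> X = subcube_map S \<phi> Y"
    then have "card (sym_diff X Y) = 0" using card_eq[of X Y] by simp
    moreover have "finite (sym_diff X Y)" using XY by (auto intro: finite_subset)
    ultimately show "X = Y" by auto
  qed
  then show ?thesis
    using image card_eq by (auto simp: induced_embedding_def verts_hypercube hypercube_edge_iff)
qed

definition down_directions :: "'a set ugraph \<Rightarrow> 'a set \<Rightarrow> 'a set" where
  "down_directions H X = {x \<in> X. {X, X - {x}} \<in> edges H}"

lemma card_edges_eq_sum_down_directions:
  assumes "edges H \<subseteq> edges (hypercube n)"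
  shows "card (edges H) = (\<Sum>X\<in>Pow {1..n}. card (down_directions H X))"
proof -
  let ?P = "SIGMA X:Pow {1..n}. down_directions H X"
  have "bij_betw (\<lambda>(X, x). {X, X - {x}}) ?P (edges H)"
  proof (rule bij_betw_imageI)
    show "inj_on (\<lambda>(X, x). {X, X - {x}}) ?P"
      by (auto simp: inj_on_def doubleton_eq_iff down_directions_def)
    show "(\<lambda>(X, x). {X, X - {x}}) ` ?P = edges H"
    proof (intro equalityI subsetI)
      fix e assume e: "e \<in> edges H"
      with assms obtain X x where X: "X \<subseteq> {1..n}" "x \<in> X" "e = {X, X - {x}}"
        using hypercube_edgeE by blast
      then show "e \<in> (\<lambda>(X, x). {X, X - {x}}) ` ?P"
        using e by (intro image_eqI[of _ _ "(X, x)"]) (auto simp: down_directions_def)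
    qed (auto simp: down_directions_def)
  qed
  from bij_betw_same_card[OF this] show ?thesis
    by (subst (asm) card_SigmaI) (auto simp: down_directions_def intro: finite_subset)
qed

lemma sum_card_Pow:
  assumes "finite A"
  shows "2 * (\<Sum>X\<in>Pow A. card X) = card A * 2 ^ card A"
proof -
  have "(\<Sum>X\<in>Pow A. card X) = (\<Sum>X\<in>Pow A. card (A - X))"
    by (rule sum.reindex_bij_witness[where i = "\<lambda>X. A - X" and j = "\<lambda>X. A - X"])
      (auto simp: double_diff)
  then have "2 * (\<Sum>X\<in>Pow A. card X) = (\<Sum>X\<in>Pow A. card X + card (A - X))"
    by (simp add: sum.distrib)
  also have "\<dots> = (\<Sum>X\<in>Pow A. card A)"
    using assms by (intro sum.cong) (auto simp: card_Diff_subset card_mono finite_subset)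
  finally show ?thesis using assms by (simp add: card_Pow)
qed

lemma card_edges_hypercube: "2 * card (edges (hypercube n)) = n * 2 ^ n"
proof -
  have "down_directions (hypercube n) X = X" if "X \<subseteq> {1..n}" for X
    using that by (auto simp: down_directions_def hypercube_edgeI)
  then have "card (edges (hypercube n)) = (\<Sum>X\<in>Pow {1..n}. card X)"
    unfolding card_edges_eq_sum_down_directions[OF subset_refl] by (intro sum.cong) auto
  then show ?thesis using sum_card_Pow[of "{1..n}"] by simp
qed

text \<open>Membership of \<open>S \<union> set xs\<close> in \<open>verts H\<close> follows from the last condition unless \<open>k = 0\<close>, when
  a down star is a single vertex.\<close>

definition star_tuples :: "nat \<Rightarrow> 'a set ugraph \<Rightarrow> 'a set \<Rightarrow> 'a list set" where
  "star_tuples k H S = {xs. length xs = k \<and> set xs \<inter> S = {} \<and>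
     S \<union> set xs \<in> verts H \<and> set xs \<subseteq> down_directions H (S \<union> set xs)}"

lemma star_tuples_subset:
  assumes "subgraph H (hypercube n)"
  shows "star_tuples k H S \<subseteq> tuples k ({1..n} - S)"
  using assms by (auto simp: star_tuples_def tuples_def subgraph_def verts_hypercube)

lemma sum_card_tuples_down_directions_le:
  assumes H: "subgraph H (hypercube n)" and "k > 0"
  shows "(\<Sum>X\<in>Pow {1..n}. card (tuples k (down_directions H X)))
           \<le> (\<Sum>S\<in>Pow {1..n}. card (star_tuples k H S))"
proof -
  let ?T = "SIGMA X:Pow {1..n}. tuples k (down_directions H X)"
  let ?E = "SIGMA S:Pow {1..n}. star_tuples k H S"
  have finite_tuples_dirs: "finite (tuples k (down_directions H X))" if "X \<subseteq> {1..n}" for X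
    using that by (auto simp: down_directions_def intro: finite_tuples finite_subset)
  have finite_star_tuples: "finite (star_tuples k H S)" for S
    using star_tuples_subset[OF H] by (rule finite_subset) (simp add: finite_tuples)
  have "card ?T \<le> card ?E"
  proof (rule card_inj_on_le)
    show "inj_on (\<lambda>(X, xs). (X - set xs, xs)) ?T"
      by (rule inj_onI) (auto simp: tuples_def down_directions_def)
    show "(\<lambda>(X, xs). (X - set xs, xs)) ` ?T \<subseteq> ?E"
    proof clarify
      fix X xs assume X: "X \<subseteq> {1..n}" and xs: "xs \<in> tuples k (down_directions H X)"
      then have X_eq: "X \<union> set xs = X"
        by (auto simp: tuples_def down_directions_def)
      obtain x where "x \<in> set xs" using xs \<open>k > 0\<close> by (cases xs) (auto simp: tuples_def)
      then have "{X, X - {x}} \<in> edges H" using xs by (auto simp: tuples_def down_directions_def)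
      then have "X \<in> verts H" using H by (auto simp: subgraph_def simple_graph_def)
      then show "X - set xs \<in> Pow {1..n} \<and> xs \<in> star_tuples k H (X - set xs)"
        using X xs by (auto simp: star_tuples_def X_eq tuples_def)
    qed
  qed (simp add: finite_star_tuples)
  then show ?thesis by (simp add: finite_tuples_dirs finite_star_tuples)
qed

lemma base_with_many_star_tuples_exists:
  fixes d :: real
  assumes H: "subgraph H (hypercube n)" and "d > 0" and dens: "2 ^ n * d \<le> card (edges H)"
  obtains S where "S \<subseteq> {1..n}" "d ^ k \<le> card (star_tuples k H S)"
proof (cases "k = 0")
  case True
  have "0 < 2 ^ n * d" using \<open>d > 0\<close> by simp
  then have "edges H \<noteq> {}" using dens by auto
  then obtain e where "e \<in> edges H" by blast
  moreover have "simple_graph H" using H by (simp add: subgraph_def)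
  ultimately obtain S where S: "S \<in> verts H" by (elim simple_graph_edgeE)
  then have "star_tuples k H S = {[]}" using True by (auto simp: star_tuples_def)
  moreover have "S \<subseteq> {1..n}" using H S by (auto simp: subgraph_def verts_hypercube)
  ultimately show thesis using that True by simp
next
  case False
  have "edges H \<subseteq> edges (hypercube n)" using H by (simp add: subgraph_def)
  then have "card (Pow {1..n}) * d \<le> (\<Sum>X\<in>Pow {1..n}. real (card (down_directions H X)))"
    using dens by (simp add: card_edges_eq_sum_down_directions card_Pow)
  then have "card (Pow {1..n}) * d ^ k \<le> (\<Sum>X\<in>Pow {1..n}. real (card (down_directions H X)) ^ k)"
    using \<open>d > 0\<close> by (intro card_mult_power_le_sum_power) auto
  also have "\<dots> = real (\<Sum>X\<in>Pow {1..n}. card (tuples k (down_directions H X)))"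
    unfolding of_nat_sum
    by (intro sum.cong refl) (auto simp: card_tuples down_directions_def finite_subset)
  also have "\<dots> \<le> real (\<Sum>S\<in>Pow {1..n}. card (star_tuples k H S))"
    using sum_card_tuples_down_directions_le[OF H, of k] False by (intro of_nat_mono) simp
  finally have "\<exists>S\<in>Pow {1..n}. d ^ k \<le> card (star_tuples k H S)"
    by (intro exists_ge_average) auto
  then show thesis using that by blast
qed

lemma down_nbrs_eq:
  assumes "X \<in> vertex_layer n k"
  shows "down_nbrs n k X = (\<lambda>x. X - {x}) ` X"
proof -
  have X: "X \<subseteq> {1..n}" "finite X" "card X = k"
    using assms by (auto simp: in_vertex_layer_iff intro: finite_subset)
  show ?thesis
  proof (intro equalityI subsetI)
    fix Y assume "Y \<in> down_nbrs n k X"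
    then have card_Y: "card Y = k - 1" and edge: "{X, Y} \<in> edges (hypercube n)"
      by (auto simp: down_nbrs_def in_vertex_layer_iff)
    from edge obtain Z z where Z: "z \<in> Z" "{X, Y} = {Z, Z - {z}}" by (rule hypercube_edgeE)
    have "\<not> (Y = Z \<and> X = Z - {z})"
      using X(2,3) card_Y card.remove[of Z z] Z(1) by auto
    then show "Y \<in> (\<lambda>x. X - {x}) ` X" using Z by (auto simp: doubleton_eq_iff)
  next
    fix Y assume "Y \<in> (\<lambda>x. X - {x}) ` X"
    then show "Y \<in> down_nbrs n k X"
      using X by (auto simp: down_nbrs_def in_vertex_layer_iff hypercube_edgeI)
  qed
qed

lemma down_stars_union_image_subset:
  assumes H: "simple_graph H" and A: "A \<subseteq> vertex_layer m k"
    and \<phi>: "inj_on \<phi> {1..m}" "\<phi> ` {1..m} \<inter> S = {}"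
    and stars: "\<And>a. a \<in> A \<Longrightarrow> subcube_map S \<phi> a \<in> verts H \<and>
      \<phi> ` a \<subseteq> down_directions H (subcube_map S \<phi> a)"
  shows "subcube_map S \<phi> ` verts (down_stars_union m k A) \<subseteq> verts H"
    and "\<And>e. e \<in> edges (down_stars_union m k A) \<Longrightarrow> subcube_map S \<phi> ` e \<in> edges H"
proof -
  have edge: "{subcube_map S \<phi> a, subcube_map S \<phi> (a - {p})} \<in> edges H" if "a \<in> A" "p \<in> a" for a p
  proof -
    have "a \<subseteq> {1..m}" using subsetD[OF A that(1)] by (simp add: in_vertex_layer_iff)
    then show ?thesis
      using stars[OF that(1)] that(2) by (auto simp: subcube_map_remove[OF \<phi>] down_directions_def)
  qed
  have vert: "subcube_map S \<phi> (a - {p}) \<in> verts H" if "a \<in> A" "p \<in> a" for a p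
    using edge[OF that] H by (auto simp: simple_graph_def)
  have nbrs: "down_nbrs m k a = (\<lambda>p. a - {p}) ` a" if "a \<in> A" for a
    using subsetD[OF A that] by (rule down_nbrs_eq)
  show "subcube_map S \<phi> ` verts (down_stars_union m k A) \<subseteq> verts H"
    using stars vert nbrs by (auto simp: down_stars_union_def down_star_def)
  show "subcube_map S \<phi> ` e \<in> edges H" if "e \<in> edges (down_stars_union m k A)" for e
    using that edge nbrs by (auto simp: down_stars_union_def down_star_def)
qed

lemma contains_copy_if_star_tuples_contain_grid:
  assumes A: "A \<subseteq> vertex_layer m k" "k_partite k (layer_hypergraph m A)"
    and G': "subgraph G' (down_stars_union m k A)" "induced_subgraph G' (hypercube m)"
      "isomorphic G G'"
    and H: "subgraph H (hypercube n)" and S: "S \<subseteq> {1..n}"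
    and Bs: "Bs \<in> tuples k {B. card B = Suc m}" "listset Bs \<subseteq> star_tuples k H S"
      "disjoint_family_on ((!) Bs) {..<k}"
  shows "contains_copy_induced_in (hypercube n) H G"
proof -
  have A_subset: "a \<subseteq> {1..m}" if "a \<in> A" for a
    using subsetD[OF A(1) that] by (simp add: in_vertex_layer_iff)
  obtain \<phi> where \<phi>_inj: "inj_on \<phi> {1..m}" and \<phi>_blocks: "\<phi> ` {1..m} \<subseteq> \<Union>(set Bs)"
    and \<phi>_edges: "\<And>a. a \<in> A \<Longrightarrow> \<exists>xs\<in>listset Bs. set xs = \<phi> ` a"
    using k_partite_embeds_in_grid[OF A(2) _ _ _ Bs(1,3)] A_subset
    by (auto simp: layer_hypergraph_def)
  have "listset Bs \<subseteq> tuples k ({1..n} - S)"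
    using Bs(2) star_tuples_subset[OF H] by (rule subset_trans)
  moreover have "{} \<notin> set Bs" using Bs(1) by (auto simp: tuples_def)
  ultimately have "\<Union>(set Bs) \<subseteq> {1..n} - S"
    using subset_if_listset_subset_tuples by (intro Union_least)
  with \<phi>_blocks have \<phi>_image: "\<phi> ` {1..m} \<subseteq> {1..n} - S" by (rule subset_trans)
  have stars: "subcube_map S \<phi> a \<in> verts H \<and> \<phi> ` a \<subseteq> down_directions H (subcube_map S \<phi> a)"
    if a: "a \<in> A" for a
  proof -
    obtain xs where "xs \<in> star_tuples k H S" and xs: "set xs = \<phi> ` a"
      using \<phi>_edges[OF a] Bs(2) by blast
    then show ?thesis by (simp add: star_tuples_def subcube_map_def xs)
  qed
  have "simple_graph H" "\<phi> ` {1..m} \<inter> S = {}"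
    using H \<phi>_image by (auto simp: subgraph_def)
  note embeds = down_stars_union_image_subset[OF this(1) A(1) \<phi>_inj this(2) stars]
  show ?thesis
    using induced_embedding_subcube_map[OF S \<phi>_inj \<phi>_image] simple_graph_hypercube G'(2,3)
  proof (rule contains_copy_induced_in_if_embedding)
    show "subcube_map S \<phi> ` verts G' \<subseteq> verts H"
      using embeds(1) G'(1) by (auto simp: subgraph_def)
    show "subcube_map S \<phi> ` e \<in> edges H" if "e \<in> edges G'" for e
      using embeds(2) G'(1) that by (auto simp: subgraph_def)
  qed
qed

theorem eventually_dense_subgraph_contains_copy:
  fixes c :: real
  assumes "has_induced_partite_representation k G" and "c > 0"
  shows "\<forall>\<^sub>F n in sequentially. \<forall>H. subgraph H (hypercube n) \<and>
    c * card (edges (hypercube n)) \<le> card (edges H) \<longrightarrow> contains_copy_induced_in (hypercube n) H G"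
proof -
  obtain m A G' where rep: "A \<subseteq> vertex_layer m k" "k_partite k (layer_hypergraph m A)"
    "subgraph G' (down_stars_union m k A)" "induced_subgraph G' (hypercube m)" "isomorphic G G'"
    using assms(1) unfolding has_induced_partite_representation_def by blast
  have "(c / 2) ^ k > 0" using \<open>c > 0\<close> by simp
  from eventually_dense_contains_disjoint_grid[where 'a = nat and k = k,
      OF this zero_less_Suc[of m]]
    eventually_gt_at_top[of 0]
  show ?thesis
  proof eventually_elim
    case (elim n)
    show ?case
    proof (intro allI impI, elim conjE)
      fix H assume H: "subgraph H (hypercube n)"
        and dens: "c * card (edges (hypercube n)) \<le> card (edges H)"
      have "real (2 * card (edges (hypercube n))) = real (n * 2 ^ n)"
        by (simp only: card_edges_hypercube)
      then have "2 ^ n * (c / 2 * n) = c * card (edges (hypercube n))" by (simp add: mult_ac)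
      with dens have "2 ^ n * (c / 2 * n) \<le> card (edges H)" by (simp only:)
      moreover have "c / 2 * n > 0" using \<open>c > 0\<close> elim(2) by simp
      ultimately obtain S where S: "S \<subseteq> {1..n}" "(c / 2 * n) ^ k \<le> card (star_tuples k H S)"
        using base_with_many_star_tuples_exists[OF H] by metis
      then have "(c / 2) ^ k * n ^ k \<le> card (star_tuples k H S)"
        unfolding power_mult_distrib by simp
      moreover have "star_tuples k H S \<subseteq> tuples k {1..n}"
        using star_tuples_subset[OF H] by (fastforce simp: tuples_def)
      ultimately obtain Bs where "Bs \<in> tuples k {B. card B = Suc m}"
        "listset Bs \<subseteq> star_tuples k H S" "disjoint_family_on ((!) Bs) {..<k}"
        using elim(1)[rule_format, of "{1..n}" "star_tuples k H S"] by auto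
      then show "contains_copy_induced_in (hypercube n) H G"
        using rep H S(1) by (intro contains_copy_if_star_tuples_contain_grid)
    qed
  qed
qed

section \<open>The extremal numbers\<close>

lemma ex_cube_induced_le:
  fixes b :: real
  assumes "0 \<le> b"
    and copy: "\<And>H. subgraph H (hypercube n) \<Longrightarrow> b \<le> card (edges H) \<Longrightarrow>
      contains_copy_induced_in (hypercube n) H G"
  shows "ex_cube_induced n G \<le> b"
proof -
  let ?A = "{card (edges H) | H. subgraph H (hypercube n) \<and>
    \<not> contains_copy_induced_in (hypercube n) H G}"
  have "x \<le> nat \<lfloor>b\<rfloor>" if "x \<in> ?A" for x
    using that copy by (force intro: le_nat_floor)
  then have "Sup ?A \<le> nat \<lfloor>b\<rfloor>"
    by (cases "?A = {}") (simp add: Sup_nat_def, intro cSup_least)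
  then show ?thesis using \<open>0 \<le> b\<close> unfolding ex_cube_induced_def by linarith
qed

lemma ex_induced_le_ex_cube_induced: "ex_induced n G \<le> ex_cube_induced n G"
proof -
  let ?A = "{card (edges H) | H. subgraph H (hypercube n) \<and> \<not> contains_induced_copy H G}"
  let ?B = "{card (edges H) | H. subgraph H (hypercube n) \<and>
    \<not> contains_copy_induced_in (hypercube n) H G}"
  have "?A \<subseteq> ?B" using contains_induced_copy_if_contains_copy_induced_in by blast
  moreover have "bdd_above ?B"
    by (rule bdd_aboveI[of _ "card (edges (hypercube n))"])
      (auto simp: subgraph_def
        intro!: card_mono finite_edges_if_simple_graph simple_graph_hypercube)
  ultimately show ?thesis
    unfolding ex_induced_def ex_cube_induced_def
    by (cases "?A = {}") (simp add: Sup_nat_def, intro cSup_subset_mono)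
qed

theorem theoremA1:
  fixes G :: "'a ugraph" and k :: nat
  assumes "simple_graph G"
    and "has_induced_partite_representation k G"
  shows "(\<lambda>n. real (ex_induced n G)) \<in> o(\<lambda>n. real (card (edges (hypercube n)))) \<and>
         (\<lambda>n. real (ex_cube_induced n G)) \<in> o(\<lambda>n. real (card (edges (hypercube n))))"
proof
  show cube: "(\<lambda>n. real (ex_cube_induced n G)) \<in> o(\<lambda>n. real (card (edges (hypercube n))))"
  proof (rule landau_o.smallI)
    fix c :: real assume "c > 0"
    from eventually_dense_subgraph_contains_copy[OF assms(2) this]
    show "\<forall>\<^sub>F n in sequentially.
        norm (real (ex_cube_induced n G)) \<le> c * norm (real (card (edges (hypercube n))))"
    proof eventually_elim
      case (elim n)
      then have "ex_cube_induced n G \<le> c * card (edges (hypercube n))"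
        using \<open>c > 0\<close> by (intro ex_cube_induced_le) auto
      then show ?case by simp
    qed
  qed
  have "(\<lambda>n. real (ex_induced n G)) \<in> O(\<lambda>n. real (ex_cube_induced n G))"
    by (intro landau_o.big_mono always_eventually) (simp add: ex_induced_le_ex_cube_induced)
  then show "(\<lambda>n. real (ex_induced n G)) \<in> o(\<lambda>n. real (card (edges (hypercube n))))"
    using cube by (rule landau_o.big_small_trans)
qed

end
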